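(* Let $X$ be a Banach space. Then (equalities of vector spaces): i. $M'(\Sigma\ell_\infty(\mathbb K),\Sigma\ell_\infty(X))=bv_w(X)=M'(\Sigma c(\mathbb K),\Sigma c(X))$. ii. $M(\Sigma\ell_\infty(X),\Sigma\ell_\infty(X))=bv(\mathbb K)=M(\Sigma c(X),\Sigma c(X))$.
   Context: $\mathbb K=\mathbb R$ or $\mathbb C$; $S(X)$ is the space of all sequences in $X$. $\Sigma\ell_\infty(X)$ is the space of sequences in $X$ whose sequence of partial sums is bounded; $\Sigma c(X)$ is the space of sequences $\{x_n\}_n$ in $X$ for which $\sum_n x_n$ converges. For $V\subseteq S(\mathbb K)$, $W\subseteq S(X)$: $M'(V,W):=\{f\in S(X): v\cdot f\in W\ \forall v\in V\}$. For $V,W\subseteq S(X)$: $M(V,W):=\{f\in S(\mathbb K): f\cdot v\in W\ \forall v\in V\}$. Products are coordinatewise, $(f\cdot v)(n)=f(n)v(n)$. $bv(\mathbb K)$ is the space of scalar sequences $\{x_n\}_n$ with $\sum_n|x_{n+1}-x_n|<\infty$, and $bv_w(X):=\{s\in S(X):\{\langle s(n),x^*\rangle\}_n\in bv(\mathbb K)\ \forall x^*\in X^*\}$.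
   Formalization: Part (ii) is stated for X ≠ {0}; for X = {0} it fails, since every scalar sequence is then a multiplier and M(Σℓ∞(X),Σℓ∞(X)) = S(K) ≠ bv(K). *)

theory Defs
  imports "HOL-Analysis.Analysis"
begin

text \<open>
  A normed space over \<open>K = \<real>\<close> or \<open>K = \<complex>\<close> is a type \<open>'a\<close> of class \<^class>\<open>real_normed_vector\<close>
  together with its scalar multiplication \<open>sc :: 'k \<Rightarrow> 'a \<Rightarrow> 'a\<close>, where \<open>'k\<close> is \<^typ>\<open>real\<close> or
  \<^typ>\<open>complex\<close>.  For \<open>K = \<real>\<close> this is \<^const>\<open>scaleR\<close>; for \<open>K = \<complex>\<close>, where the libraries have
  no class, it satisfies the following locale.
\<close>

locale complex_banach_space = vector_space scaleC
  for scaleC :: "complex \<Rightarrow> 'a::banach \<Rightarrow> 'a" +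
  assumes scaleC_of_real: "scaleC (of_real r) x = r *\<^sub>R x"
    and norm_scaleC: "norm (scaleC c x) = norm c * norm x"

lemma complex_banach_space_complex: "complex_banach_space ((*) :: complex \<Rightarrow> complex \<Rightarrow> complex)"
  by unfold_locales (auto simp: algebra_simps norm_mult scaleR_conv_of_real)

definition Sigma_linf :: "(nat \<Rightarrow> 'a::real_normed_vector) set"
  where "Sigma_linf = {x. bounded (range (\<lambda>n. \<Sum>k\<le>n. x k))}"

definition Sigma_c :: "(nat \<Rightarrow> 'a::real_normed_vector) set"
  where "Sigma_c = {x. summable x}"

definition bv :: "(nat \<Rightarrow> 'k::real_normed_field) set"
  where "bv = {x. summable (\<lambda>n. norm (x (Suc n) - x n))}"

text \<open>The dual space of \<open>K\<close>-valued functionals: \<^const>\<open>bounded_linear\<close> gives only additivity,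
  real homogeneity and boundedness, so \<open>K\<close>-homogeneity is required separately.\<close>

definition dual_space :: "('k::real_normed_field \<Rightarrow> 'a::real_normed_vector \<Rightarrow> 'a) \<Rightarrow> ('a \<Rightarrow> 'k) set"
  where "dual_space sc = {\<phi>. bounded_linear \<phi> \<and> (\<forall>c x. \<phi> (sc c x) = c * \<phi> x)}"

lemma dual_space_scaleR: "dual_space scaleR = Collect bounded_linear"
  by (auto simp: dual_space_def linear_simps)

definition bv_w :: "('k::real_normed_field \<Rightarrow> 'a::real_normed_vector \<Rightarrow> 'a) \<Rightarrow> (nat \<Rightarrow> 'a) set"
  where "bv_w sc = {s. \<forall>\<phi>\<in>dual_space sc. (\<lambda>n. \<phi> (s n)) \<in> bv}"

text \<open>\<open>mult_vec\<close> is \<open>M'(V, W)\<close> (vector-valued multipliers of scalar sequences), and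
  \<open>mult_scal\<close> is \<open>M(V, W)\<close> (scalar multipliers of vector sequences).\<close>

definition mult_vec ::
    "('k \<Rightarrow> 'a \<Rightarrow> 'a) \<Rightarrow> (nat \<Rightarrow> 'k) set \<Rightarrow> (nat \<Rightarrow> 'a) set \<Rightarrow> (nat \<Rightarrow> 'a) set"
  where "mult_vec sc V W = {f. \<forall>v\<in>V. (\<lambda>n. sc (v n) (f n)) \<in> W}"

definition mult_scal ::
    "('k \<Rightarrow> 'a \<Rightarrow> 'a) \<Rightarrow> (nat \<Rightarrow> 'a) set \<Rightarrow> (nat \<Rightarrow> 'a) set \<Rightarrow> (nat \<Rightarrow> 'k) set"
  where "mult_scal sc V W = {f. \<forall>v\<in>V. (\<lambda>n. sc (f n) (v n)) \<in> W}"

end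

theory Submission
  imports Defs
begin

text \<open>
  Let \<open>V\<close> be the partial sums of \<open>v\<close> and \<open>\<Delta>f\<close> the differences of \<open>f\<close>.  Summation by parts writes the
  \<open>n\<close>-th partial sum of \<open>v \<cdot> f\<close> as \<open>V n \<cdot> f n - (\<Sum>k<n. V k \<cdot> \<Delta>f k)\<close>.  If \<open>f\<close> is weakly of bounded
  variation, the sums \<open>\<Sum>k<n. a k \<cdot> \<Delta>f k\<close> with \<open>\<bar>a k\<bar> \<le> 1\<close> are weakly bounded, hence bounded in norm, and so
  the partial sums of \<open>v \<cdot> f\<close> are at most a constant times the supremum of the \<open>\<bar>V k\<bar>\<close>.  Applied to
  \<open>v\<close> this gives bounded partial sums, applied to tails of \<open>v\<close> the Cauchy criterion.  Conversely, both
  kinds of multipliers map \<open>\<Sigma>c\<close> into \<open>\<Sigma>\<ell>\<^sub>\<infinity>\<close>, and applying functionals reduces the question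
  to a real sequence \<open>a\<close>; if \<open>a\<close> had infinite variation, with \<open>S n\<close> its variation up to \<open>n\<close>, the
  choice \<open>V k = - sgn (\<Delta>a k) / sqrt (1 + S k)\<close>, which tends to \<open>0\<close>, would give \<open>v \<cdot> a\<close> unbounded
  partial sums.
\<close>

subsection \<open>Hahn-Banach and uniform boundedness\<close>

text \<open>Homogeneity is only an inequality for positive factors, which is easy to check for
  infima; equality follows in \<open>sublinear_scaleR\<close>.\<close>

definition sublinear :: "('a::real_vector \<Rightarrow> real) \<Rightarrow> bool"
  where "sublinear p \<longleftrightarrow> (\<forall>x y. p (x + y) \<le> p x + p y) \<and> (\<forall>c x. 0 < c \<longrightarrow> p (c *\<^sub>R x) \<le> c * p x)"

lemma sublinear_add: "sublinear p \<Longrightarrow> p (x + y) \<le> p x + p y"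
  by (simp add: sublinear_def)

lemma sublinear_scaleR:
  assumes "sublinear p" "0 \<le> c"
  shows "p (c *\<^sub>R x) = c * p x"
proof (cases "c = 0")
  case True
  \<comment> \<open>The factor \<open>1/2\<close> gives \<open>p 0 \<le> 0\<close>, the factor
    \<open>2\<close> gives \<open>0 \<le> p 0\<close>.\<close>
  have "p ((1/2) *\<^sub>R 0) \<le> (1/2) * p 0" "p (2 *\<^sub>R 0) \<le> 2 * p 0"
    using assms(1) unfolding sublinear_def by (meson zero_less_numeral zero_less_divide_1_iff)+
  with True show ?thesis by simp
next
  case False
  with assms have c: "0 < c" by simp
  have "p (inverse c *\<^sub>R (c *\<^sub>R x)) \<le> inverse c * p (c *\<^sub>R x)" "p (c *\<^sub>R x) \<le> c * p x"
    using assms(1) c unfolding sublinear_def by (meson positive_imp_inverse_positive)+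
  with c show ?thesis by (simp add: field_simps)
qed

lemma sublinear_ge:
  assumes "sublinear p"
  shows "- p (- x) \<le> p x"
  using sublinear_add[OF assms, of x "- x"] sublinear_scaleR[OF assms, of 0 0] by simp

text \<open>The witness is \<open>q y = (INF t\<in>{0..}. p (y + t *\<^sub>R x) - t * p x)\<close>.  Starting from the norm, it
  yields a functional that is norming at \<open>x\<close>; applied to a minimal \<open>p\<close>, it shows that \<open>p\<close> is odd and
  hence linear.  So Hahn-Banach needs no extension from subspaces.\<close>

lemma sublinear_shift:
  fixes p :: "'a::real_vector \<Rightarrow> real"
  assumes p: "sublinear p"
  obtains q where "sublinear q" "q \<le> p" "q (- x) \<le> - p x"
proof
  define g where "g y t = p (y + t *\<^sub>R x) - t * p x" for y t
  define q where "q y = (INF t\<in>{0..}. g y t)" for y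
  \<comment> \<open>Subadditivity for \<open>t *\<^sub>R x\<close> as the sum of
    \<open>y + t *\<^sub>R x\<close> and \<open>- y\<close> keeps the infimum finite.\<close>
  have lb: "- p (- y) \<le> g y t" if "0 \<le> t" for y t
    using sublinear_add[OF p, of "y + t *\<^sub>R x" "- y"] sublinear_scaleR[OF p that, of x]
    by (simp add: g_def)
  have bdd: "bdd_below (g y ` {0..})" for y
    by (rule bdd_belowI2[where m = "- p (- y)"]) (use lb in auto)
  have le: "q y \<le> g y t" if "0 \<le> t" for y t
    unfolding q_def by (rule cINF_lower[OF bdd]) (use that in auto)
  have ge: "m \<le> q y" if "\<And>t. 0 \<le> t \<Longrightarrow> m \<le> g y t" for m y
    unfolding q_def by (rule cINF_greatest) (use that in auto)
  show "sublinear q"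
    unfolding sublinear_def
  proof (intro conjI allI impI)
    fix y z
    \<comment> \<open>Shifts add up: \<open>s + t\<close> is admissible for \<open>y + z\<close>.
      Taking infima over \<open>s\<close>, then over \<open>t\<close>, gives subadditivity.\<close>
    have "q (y + z) \<le> g y s + g z t" if "0 \<le> s" "0 \<le> t" for s t
      using le[of "s + t" "y + z"] sublinear_add[OF p, of "y + s *\<^sub>R x" "z + t *\<^sub>R x"] that
      by (simp add: g_def algebra_simps)
    then have "q (y + z) - g z t \<le> q y" if "0 \<le> t" for t
      using that by (intro ge) (simp add: algebra_simps)
    then have "q (y + z) - q y \<le> q z"
      by (intro ge) (simp add: algebra_simps)
    then show "q (y + z) \<le> q y + q z" by simp
  next
    fix c :: real and y assume c: "0 < c"
    have "q (c *\<^sub>R y) / c \<le> g y t" if "0 \<le> t" for t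
      using le[of "c * t" "c *\<^sub>R y"] sublinear_scaleR[OF p, of c "y + t *\<^sub>R x"] that c
      by (simp add: g_def field_simps scaleR_add_right)
    then have "q (c *\<^sub>R y) / c \<le> q y" by (rule ge)
    then show "q (c *\<^sub>R y) \<le> c * q y" using c by (simp add: field_simps)
  qed
  show "q \<le> p"
    using le[of 0] by (simp add: le_fun_def g_def)
  show "q (- x) \<le> - p x"
    using le[of 1 "- x"] sublinear_scaleR[OF p, of 0 0] by (simp add: g_def)
qed

text \<open>Zorn's lemma for the reversed pointwise order: the pointwise infimum of a chain is again
  sublinear, and \<open>- p (- y)\<close> keeps it finite.\<close>

lemma minimal_sublinear:
  fixes p :: "'a::real_vector \<Rightarrow> real"
  assumes p: "sublinear p"
  obtains m where "sublinear m" "m \<le> p" "\<And>q. sublinear q \<Longrightarrow> q \<le> m \<Longrightarrow> q = m"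
proof -
  define A where "A = {q. sublinear q \<and> q \<le> p}"
  have "\<exists>m\<in>A. \<forall>q\<in>A. m \<ge> q \<longrightarrow> q = m"
  proof (rule predicate_Zorn)
    show "partial_order_on A (relation_of (\<ge>) A)"
      by (rule partial_order_on_relation_ofI) auto
    fix C assume "C \<in> Chains (relation_of (\<ge>) A)"
    then have CA: "C \<subseteq> A" and chain: "\<And>q r. q \<in> C \<Longrightarrow> r \<in> C \<Longrightarrow> q \<le> r \<or> r \<le> q"
      unfolding Chains_def relation_of_def by blast+
    show "\<exists>u\<in>A. \<forall>q\<in>C. q \<ge> u"
    proof (cases "C = {}")
      case True
      with p show ?thesis by (auto simp: A_def)
    next
      case False
      define u where "u y = (INF q\<in>C. q y)" for y
      have lb: "- p (- y) \<le> q y" if "q \<in> C" for q y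
      proof -
        have "q (- y) \<le> p (- y)" "sublinear q" using that CA by (auto simp: A_def le_fun_def)
        then show ?thesis using sublinear_ge[of q y] by linarith
      qed
      have bdd: "bdd_below ((\<lambda>q. q y) ` C)" for y
        by (rule bdd_belowI2[where m = "- p (- y)"]) (use lb in auto)
      have le: "u y \<le> q y" if "q \<in> C" for q y
        unfolding u_def by (rule cINF_lower[OF bdd]) (use that in auto)
      have ge: "m \<le> u y" if "\<And>q. q \<in> C \<Longrightarrow> m \<le> q y" for m y
        unfolding u_def by (rule cINF_greatest) (use that False in auto)
      have "sublinear u"
        unfolding sublinear_def
      proof (intro conjI allI impI)
        fix y z
        \<comment> \<open>Members of a chain are comparable, so the smaller of \<open>q\<close> and
          \<open>r\<close> serves both terms.\<close>
        have "u (y + z) \<le> q y + r z" if qr: "q \<in> C" "r \<in> C" for q r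
        proof -
          obtain w where w: "w \<in> C" "w \<le> q" "w \<le> r"
            using chain[OF qr] qr by blast
          have "u (y + z) \<le> w (y + z)" by (rule le[OF w(1)])
          also have "\<dots> \<le> w y + w z" using w(1) CA by (auto simp: A_def intro: sublinear_add)
          also have "\<dots> \<le> q y + r z" using w by (auto simp: le_fun_def intro: add_mono)
          finally show ?thesis .
        qed
        then have "u (y + z) - r z \<le> u y" if "r \<in> C" for r
          using that by (intro ge) (simp add: algebra_simps)
        then have "u (y + z) - u y \<le> u z"
          by (intro ge) (simp add: algebra_simps)
        then show "u (y + z) \<le> u y + u z" by simp
      next
        fix c :: real and y assume c: "0 < c"
        have "u (c *\<^sub>R y) / c \<le> q y" if "q \<in> C" for q
        proof -
          have "sublinear q" using that CA by (auto simp: A_def)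
          then show ?thesis
            using le[OF that, of "c *\<^sub>R y"] sublinear_scaleR[of q c y] c by (simp add: field_simps)
        qed
        then have "u (c *\<^sub>R y) / c \<le> u y" by (rule ge)
        then show "u (c *\<^sub>R y) \<le> c * u y" using c by (simp add: field_simps)
      qed
      moreover have "u \<le> p"
      proof -
        obtain q where q: "q \<in> C" using False by blast
        then have "u \<le> q" by (intro le_funI le)
        also have "q \<le> p" using q CA by (auto simp: A_def)
        finally show ?thesis .
      qed
      ultimately show ?thesis using le by (auto simp: A_def le_fun_def)
    qed
  qed
  then obtain m where m: "m \<in> A" "\<And>q. q \<in> A \<Longrightarrow> q \<le> m \<Longrightarrow> q = m" by blast
  then have "q = m" if "sublinear q" "q \<le> m" for q
    using that order_trans[OF \<open>q \<le> m\<close>, of p] by (auto simp: A_def)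
  with m(1) show thesis by (intro that[of m]) (auto simp: A_def)
qed

text \<open>Once \<open>m\<close> is odd, subadditivity at \<open>- x\<close> and \<open>- y\<close>
  reverses the inequality at \<open>x\<close> and \<open>y\<close>, and oddness carries homogeneity
  over to negative factors.\<close>

lemma minimal_sublinear_linear:
  fixes m :: "'a::real_vector \<Rightarrow> real"
  assumes m: "sublinear m" and min: "\<And>q. sublinear q \<Longrightarrow> q \<le> m \<Longrightarrow> q = m"
  shows "linear m"
proof -
  have neg: "m (- x) = - m x" for x
  proof -
    obtain q where "sublinear q" "q \<le> m" "q (- x) \<le> - m x"
      by (rule sublinear_shift[OF m])
    with min have "m (- x) \<le> - m x" by blast
    with sublinear_ge[OF m, of x] show ?thesis by linarith
  qed
  show ?thesis
  proof (rule linearI)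
    fix x y
    show "m (x + y) = m x + m y"
      using sublinear_add[OF m, of x y] sublinear_add[OF m, of "- x" "- y"] neg[of "x + y"]
      by (simp add: neg)
  next
    fix c :: real and x
    show "m (c *\<^sub>R x) = c *\<^sub>R m x"
      using sublinear_scaleR[OF m, of c x] sublinear_scaleR[OF m, of "- c" x] neg[of "c *\<^sub>R x"]
      by (cases "0 \<le> c") auto
  qed
qed

text \<open>Shifting the norm at \<open>x\<close> forces every \<open>f\<close> below the result to
  satisfy \<open>f (- x) \<le> - norm x\<close>; a minimal such \<open>f\<close> is linear.\<close>

lemma norming_functional:
  fixes x :: "'a::real_normed_vector"
  obtains f :: "'a \<Rightarrow> real"
  where "bounded_linear f" "f x = norm x" "\<And>y. \<bar>f y\<bar> \<le> norm y"
proof -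
  have "sublinear (norm :: 'a \<Rightarrow> real)"
    by (auto simp: sublinear_def norm_triangle_ineq)
  then obtain p :: "'a \<Rightarrow> real" where p: "sublinear p" "p \<le> norm" "p (- x) \<le> - norm x"
    by (rule sublinear_shift)
  obtain f where f: "sublinear f" "f \<le> p" "\<And>q. sublinear q \<Longrightarrow> q \<le> f \<Longrightarrow> q = f"
    using minimal_sublinear[OF p(1)] by blast
  have lin: "linear f" by (rule minimal_sublinear_linear[OF f(1,3)])
  have le: "f y \<le> norm y" for y
    using f(2) p(2) by (auto simp: le_fun_def intro: order_trans)
  have abs: "\<bar>f y\<bar> \<le> norm y" for y
    using le[of y] le[of "- y"] linear_neg[OF lin, of y] by auto
  have "f (- x) \<le> - norm x" using f(2) p(3) by (auto simp: le_fun_def intro: order_trans)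
  then have "f x = norm x" using le[of x] linear_neg[OF lin, of x] by auto
  moreover have "bounded_linear f"
    using lin abs by (intro bounded_linear_intro[where K = 1]) (auto simp: linear_add linear_scale)
  ultimately show thesis using abs that by blast
qed

section \<open>Uniform boundedness via Baire category\<close>

text \<open>Points of \<open>A\<close> act as functionals on the dual, which is complete even when
  \<open>'a\<close> is not. By Baire, one of the closed sets \<open>F n\<close> covering it contains
  a ball.\<close>

lemma bounded_if_weakly_bounded:
  fixes A :: "'a::real_normed_vector set"
  assumes weak: "\<And>f :: 'a \<Rightarrow> real. bounded_linear f \<Longrightarrow> bounded (f ` A)"
  shows "bounded A"
proof -
  define F where "F n = {f :: 'a \<Rightarrow>\<^sub>L real. \<forall>x\<in>A. \<bar>f x\<bar> \<le> real n}" for n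
  have "\<exists>n. f \<in> F n" for f :: "'a \<Rightarrow>\<^sub>L real"
  proof -
    have "bounded (blinfun_apply f ` A)"
      by (rule weak) (rule blinfun.bounded_linear_right)
    then obtain B where B: "\<And>x. x \<in> A \<Longrightarrow> \<bar>f x\<bar> \<le> B" by (auto simp: bounded_iff)
    obtain n where "B \<le> real n" using real_arch_simple by blast
    then have "f \<in> F n" using B by (auto simp: F_def dest: order_trans)
    then show ?thesis ..
  qed
  then have U: "\<Union>(range F) = UNIV" by auto
  have closed: "closed (F n)" for n
  proof -
    have "F n = (\<Inter>x\<in>A. {f. \<bar>blinfun_apply f x\<bar> \<le> real n})" by (auto simp: F_def)
    moreover have "closed {f :: 'a \<Rightarrow>\<^sub>L real. \<bar>blinfun_apply f x\<bar> \<le> real n}" for x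
      by (intro closed_Collect_le continuous_intros)
    ultimately show ?thesis by auto
  qed
  have "\<exists>n. interior (F n) \<noteq> {}"
  proof (rule ccontr)
    assume *: "\<not> ?thesis"
    have "(euclidean :: ('a \<Rightarrow>\<^sub>L real) topology) interior_of \<Union>(range F) = {}"
      by (rule Baire_category_alt) (use * closed in \<open>auto simp: completely_metrizable_space_euclidean\<close>)
    then show False using U by simp
  qed
  then obtain n f e where e: "0 < e" "cball f e \<subseteq> F n"
    using mem_interior_cball by blast
  \<comment> \<open>The centre \<open>f\<close> and \<open>f + e *\<^sub>R G\<close> both lie in
    \<open>F n\<close>; their values at \<open>x\<close> differ by
    \<open>e * norm x\<close>.\<close>
  have "norm x \<le> 2 * real n / e" if x: "x \<in> A" for x
  proof -
    obtain g :: "'a \<Rightarrow> real" where g: "bounded_linear g" "g x = norm x" "\<And>y. \<bar>g y\<bar> \<le> norm y"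
      using norming_functional[of x] by blast
    define G where "G = Blinfun g"
    have G: "blinfun_apply G = g" by (simp add: G_def g bounded_linear_Blinfun_apply)
    have "norm G \<le> 1" by (rule norm_blinfun_bound) (auto simp: G g)
    then have "f + e *\<^sub>R G \<in> cball f e" using e by (simp add: dist_norm)
    then have "\<bar>blinfun_apply (f + e *\<^sub>R G) x\<bar> \<le> n" "\<bar>blinfun_apply f x\<bar> \<le> n"
      using e x by (auto simp: F_def subset_iff)
    then show ?thesis
      using e by (simp add: blinfun.bilinear_simps G g field_simps)
  qed
  then show ?thesis by (auto simp: bounded_iff)
qed


subsection \<open>Sequences with bounded or convergent partial sums\<close>

text \<open>The generality serves real multiplication, \<open>sc\<close> and the flipped
  \<open>sc\<close> alike.\<close>

lemma (in bounded_bilinear) sum_by_parts: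
  "(\<Sum>i\<le>n. prod (v i) (f i)) =
    prod (\<Sum>i\<le>n. v i) (f n) - (\<Sum>k<n. prod (\<Sum>i\<le>k. v i) (f (Suc k) - f k))"
  by (induction n) (simp_all add: add_left diff_right)

lemma Sigma_linf_iff: "x \<in> Sigma_linf \<longleftrightarrow> (\<exists>B. \<forall>n. norm (\<Sum>k\<le>n. x k) \<le> B)"
  by (auto simp: Sigma_linf_def bounded_iff)

lemma Sigma_c_subset_Sigma_linf: "Sigma_c \<subseteq> Sigma_linf"
proof
  fix x :: "nat \<Rightarrow> 'a" assume "x \<in> Sigma_c"
  then have "convergent (\<lambda>n. \<Sum>k\<le>n. x k)"
    by (simp add: Sigma_c_def summable_iff_convergent')
  then show "x \<in> Sigma_linf"
    by (auto simp: Sigma_linf_def convergent_def intro: convergent_imp_bounded)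
qed

lemma Sigma_linf_bounded_linear:
  assumes "bounded_linear h" "x \<in> Sigma_linf"
  shows "(\<lambda>n. h (x n)) \<in> Sigma_linf"
proof -
  have "bounded (h ` range (\<lambda>n. \<Sum>k\<le>n. x k))"
    using assms by (intro bounded_linear_image) (auto simp: Sigma_linf_def)
  moreover have "(\<Sum>k\<le>n. h (x k)) = h (\<Sum>k\<le>n. x k)" for n
    using assms(1) by (simp add: bounded_linear.linear linear_sum)
  ultimately show ?thesis by (simp add: Sigma_linf_def image_image)
qed

lemma Sigma_c_bounded_linear:
  assumes "bounded_linear h" "x \<in> Sigma_c"
  shows "(\<lambda>n. h (x n)) \<in> Sigma_c"
  using assms bounded_linear.summable by (auto simp: Sigma_c_def)

lemma bv_bounded_linear:
  assumes "bounded_linear h" "x \<in> bv"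
  shows "(\<lambda>n. h (x n)) \<in> bv"
proof -
  obtain K where K: "\<And>y. norm (h y) \<le> norm y * K"
    using bounded_linear.bounded[OF assms(1)] by blast
  have "summable (\<lambda>n. norm (x (Suc n) - x n) * K)"
    using assms(2) by (simp add: bv_def summable_mult2)
  then have "summable (\<lambda>n. norm (h (x (Suc n)) - h (x n)))"
    by (rule summable_comparison_test')
      (use K assms(1) in \<open>simp add: linear_diff[symmetric] bounded_linear.linear\<close>)
  then show ?thesis by (simp add: bv_def)
qed

section \<open>Scalar multipliers have bounded variation\<close>

lemma bv_real_if_multiplier:
  fixes a :: "nat \<Rightarrow> real"
  assumes mult: "\<And>w :: nat \<Rightarrow> real. w \<in> Sigma_c \<Longrightarrow> (\<lambda>n. w n * a n) \<in> Sigma_linf"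
  shows "a \<in> bv"
proof (rule ccontr)
  define d where "d k = \<bar>a (Suc k) - a k\<bar>" for k
  define S where "S n = (\<Sum>k<n. d k)" for n
  define r where "r n = sqrt (1 + S n)" for n
  define W where "W n = - sgn (a (Suc n) - a n) / r n" for n
  \<comment> \<open>Differences of \<open>W\<close>, so that the partial sums of \<open>w\<close>
    are \<open>W\<close> itself.\<close>
  define w where "w n = (case n of 0 \<Rightarrow> W 0 | Suc m \<Rightarrow> W (Suc m) - W m)" for n
  assume "a \<notin> bv"
  then have nsum: "\<not> summable d" by (simp add: bv_def d_def[abs_def])
  have d: "0 \<le> d k" for k by (simp add: d_def)
  have S: "0 \<le> S n" for n by (simp add: S_def d sum_nonneg)
  have r: "1 \<le> r n" "r n * r n = 1 + S n" for n using S[of n] by (simp_all add: r_def)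
  have r_nonneg: "0 \<le> r n" for n using r(1)[of n] by simp
  then have abs_r: "\<bar>r n\<bar> = r n" for n by simp
  have "filterlim S at_top sequentially"
    unfolding filterlim_at_top eventually_sequentially
  proof
    fix B
    obtain N where "B < S N"
      using nsum d summableI_nonneg_bounded[of d B] by (auto simp: S_def not_le[symmetric])
    moreover have "S N \<le> S n" if "N \<le> n" for n
      using that d by (auto simp: S_def intro: sum_mono2)
    ultimately show "\<exists>N. \<forall>n\<ge>N. B \<le> S n" by (meson less_imp_le order_trans)
  qed
  then have r_top: "filterlim r at_top sequentially"
    unfolding r_def
    by (intro filterlim_compose[OF sqrt_at_top] filterlim_tendsto_add_at_top[OF tendsto_const])
  have sum_w: "(\<Sum>i\<le>n. w i) = W n" for n
    by (induction n) (simp_all add: w_def)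
  have "W \<longlonglongrightarrow> 0"
  proof (rule Lim_null_comparison)
    show "\<forall>\<^sub>F n in sequentially. norm (W n) \<le> inverse (r n)"
      by (intro always_eventually allI) (auto simp: W_def sgn_if inverse_eq_divide abs_r r_nonneg)
    show "(\<lambda>n. inverse (r n)) \<longlonglongrightarrow> 0"
      by (rule tendsto_inverse_0_at_top[OF r_top])
  qed
  then have "w \<in> Sigma_c"
    by (auto simp: Sigma_c_def summable_iff_convergent' sum_w convergent_def)
  then obtain B where B: "\<And>n. \<bar>\<Sum>i\<le>n. w i * a i\<bar> \<le> B"
    using mult by (auto simp: Sigma_linf_iff)
  \<comment> \<open>In \<open>r\<close> the variation up to \<open>n\<close> excludes the term \<open>d n\<close>; this gains the factor \<open>2\<close> below, so that
    the boundary term \<open>W n * a n\<close>, of size at most about \<open>r n\<close>, cannot cancel the sum.\<close>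
  have r_le: "2 * (r n - 1) \<le> (\<Sum>k<n. d k / r k)" for n
  proof (induction n)
    case 0
    then show ?case by (simp add: r_def S_def)
  next
    case (Suc n)
    \<comment> \<open>The squares of \<open>r (Suc n)\<close> and \<open>r n\<close> differ by
      \<open>d n\<close>, so expanding this square bounds the increment of \<open>r\<close>.\<close>
    have "0 \<le> (r (Suc n) - r n) * (r (Suc n) - r n)" by simp
    also have "\<dots> = r (Suc n) * r (Suc n) + r n * r n - 2 * r (Suc n) * r n"
      by (simp add: algebra_simps)
    also have "\<dots> = d n + 2 * (r n * r n) - 2 * r (Suc n) * r n"
      unfolding r(2) by (simp add: S_def)
    finally have "2 * (r (Suc n) - r n) \<le> d n / r n"
      using r(1)[of n] by (simp add: field_simps)
    with Suc show ?case by simp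
  qed
  have a_le: "\<bar>a n\<bar> \<le> \<bar>a 0\<bar> + S n" for n
    by (induction n) (auto simp: S_def d_def)
  \<comment> \<open>The sum is at least \<open>2 * (r n - 1)\<close> and at most
    \<open>B + \<bar>a 0\<bar> + r n\<close>; one \<open>r n\<close> survives.\<close>
  have "r n \<le> B + 2 + \<bar>a 0\<bar>" for n
  proof -
    have "(\<Sum>i\<le>n. w i * a i) = W n * a n - (\<Sum>k<n. W k * (a (Suc k) - a k))"
      using bounded_bilinear.sum_by_parts[OF bounded_bilinear_mult, of w a n] by (simp add: sum_w)
    also have "(\<Sum>k<n. W k * (a (Suc k) - a k)) = - (\<Sum>k<n. d k / r k)"
      unfolding sum_negf[symmetric] by (intro sum.cong) (auto simp: W_def d_def sgn_if)
    finally have sum_le: "(\<Sum>k<n. d k / r k) \<le> B - W n * a n" using B[of n] by simp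
    have "\<bar>W n * a n\<bar> \<le> (\<bar>a 0\<bar> + S n) / r n"
      using a_le[of n] r(1)[of n] S[of n]
      by (auto simp: W_def abs_mult sgn_if divide_right_mono)
    moreover have "(\<bar>a 0\<bar> + S n) / r n \<le> \<bar>a 0\<bar> + r n"
    proof -
      have "\<bar>a 0\<bar> * 1 \<le> \<bar>a 0\<bar> * r n" by (intro mult_left_mono r(1)) simp
      then show ?thesis using r[of n] by (simp add: field_simps)
    qed
    ultimately have "- (W n * a n) \<le> \<bar>a 0\<bar> + r n"
      by (meson abs_le_D2 order_trans)
    with sum_le show ?thesis using r_le[of n] by argo
  qed
  moreover obtain n where "B + 2 + \<bar>a 0\<bar> < r n"
    using r_top unfolding filterlim_at_top_dense eventually_sequentially by blast
  ultimately show False by (meson not_less)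
qed

text \<open>Real coordinates inherit the multiplier property, and the norm is at most the sum of
  their absolute values. Real test sequences \<open>w\<close> handle both fields at once.\<close>

lemma bv_if_multiplier:
  fixes a :: "nat \<Rightarrow> 'k::{real_normed_field, euclidean_space}"
  assumes mult: "\<And>w :: nat \<Rightarrow> real. w \<in> Sigma_c \<Longrightarrow> (\<lambda>n. w n *\<^sub>R a n) \<in> Sigma_linf"
  shows "a \<in> bv"
proof -
  have "(\<lambda>n. a n \<bullet> b) \<in> bv" for b
  proof (rule bv_real_if_multiplier)
    fix w :: "nat \<Rightarrow> real" assume "w \<in> Sigma_c"
    with Sigma_linf_bounded_linear[OF bounded_linear_inner_left mult]
    show "(\<lambda>n. w n * (a n \<bullet> b)) \<in> Sigma_linf" by simp
  qed
  then have "summable (\<lambda>n. \<Sum>b\<in>Basis. \<bar>(a (Suc n) - a n) \<bullet> b\<bar>)"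
    by (intro summable_sum) (auto simp: bv_def inner_diff_left)
  then have "summable (\<lambda>n. norm (a (Suc n) - a n))"
    by (rule summable_comparison_test') (simp add: norm_le_l1)
  then show ?thesis by (simp add: bv_def)
qed

section \<open>From bounds on partial sums to preserved sequence spaces\<close>

lemma sum_atMost_if_ge:
  fixes g :: "nat \<Rightarrow> 'a::comm_monoid_add"
  shows "(\<Sum>i\<le>n. if m \<le> i then g i else 0) = sum g {m..<Suc n}"
proof -
  have "{..n} \<inter> {i. m \<le> i} = {m..<Suc n}" by auto
  then show ?thesis by (simp add: sum.If_cases)
qed

text \<open>\<open>t i\<close> stands for multiplication by the \<open>i\<close>-th coefficient, on
  either side of the product, so one argument serves scalar and vector multipliers.\<close>

lemma Sigma_preserved:
  fixes t :: "nat \<Rightarrow> 'c::banach \<Rightarrow> 'd::banach"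
  assumes zero: "\<And>i. t i 0 = 0"
    and bound: "\<And>v B n. (\<And>k. norm (\<Sum>i\<le>k. v i) \<le> B) \<Longrightarrow> norm (\<Sum>i\<le>n. t i (v i)) \<le> C * B"
  shows "v \<in> Sigma_linf \<Longrightarrow> (\<lambda>i. t i (v i)) \<in> Sigma_linf"
    and "v \<in> Sigma_c \<Longrightarrow> (\<lambda>i. t i (v i)) \<in> Sigma_c"
proof -
  show "v \<in> Sigma_linf \<Longrightarrow> (\<lambda>i. t i (v i)) \<in> Sigma_linf"
    using bound by (meson Sigma_linf_iff)
  assume "v \<in> Sigma_c"
  then have v: "\<forall>e>0. \<exists>N. \<forall>m\<ge>N. \<forall>n. norm (sum v {m..<n}) < e"
    unfolding Sigma_c_def mem_Collect_eq summable_Cauchy .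
  show "(\<lambda>i. t i (v i)) \<in> Sigma_c"
    unfolding Sigma_c_def mem_Collect_eq summable_Cauchy
  proof (intro allI impI)
    fix e :: real assume e: "0 < e"
    define e' where "e' = e / (1 + \<bar>C\<bar>)"
    have e': "0 < e'" using e by (simp add: e'_def)
    have "C * e' \<le> \<bar>C\<bar> * e'" using e' by (intro mult_right_mono) auto
    also have "\<dots> < e" using e by (simp add: e'_def field_simps)
    finally have Ce: "C * e' < e" .
    obtain N where N: "\<And>m n. N \<le> m \<Longrightarrow> norm (sum v {m..<n}) < e'"
      using v e' by blast
    have "norm (\<Sum>i\<in>{m..<n}. t i (v i)) < e" if m: "N \<le> m" for m n
    proof (cases n)
      case 0
      with e show ?thesis by simp
    next
      case (Suc n')
      \<comment> \<open>Cutting \<open>v\<close> off below \<open>m\<close> makes its partial sums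
        blocks of norm at most \<open>e'\<close>, to which \<open>bound\<close> applies.\<close>
      define v' where "v' i = (if m \<le> i then v i else 0)" for i
      have "norm (\<Sum>i\<le>k. v' i) \<le> e'" for k
        using N[OF m, of "Suc k"] by (simp add: v'_def sum_atMost_if_ge)
      then have "norm (\<Sum>i\<le>n'. t i (v' i)) \<le> C * e'" by (rule bound)
      also have "(\<Sum>i\<le>n'. t i (v' i)) = (\<Sum>i\<le>n'. if m \<le> i then t i (v i) else 0)"
        by (intro sum.cong) (auto simp: v'_def zero)
      also have "\<dots> = (\<Sum>i\<in>{m..<n}. t i (v i))" by (simp add: sum_atMost_if_ge Suc)
      finally show ?thesis using Ce by simp
    qed
    then show "\<exists>N. \<forall>m\<ge>N. \<forall>n. norm (\<Sum>i\<in>{m..<n}. t i (v i)) < e" by blast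
  qed
qed

subsection \<open>Multipliers over the real or complex field\<close>

text \<open>Common ground of both fields; the last assumption is uniform boundedness for the dual
  over \<open>'k\<close>, proved separately for each field.\<close>

locale banach_scaling = vector_space sc
  for sc :: "'k::{real_normed_field, euclidean_space} \<Rightarrow> 'a::banach \<Rightarrow> 'a" +
  assumes sc_of_real: "sc (of_real r) x = r *\<^sub>R x"
    and norm_sc: "norm (sc c x) = norm c * norm x"
    and bounded_if_dual_bounded: "(\<And>\<phi>. \<phi> \<in> dual_space sc \<Longrightarrow> bounded (\<phi> ` A)) \<Longrightarrow> bounded A"
begin

lemma sc_of_real_mult: "sc (of_real r * c) x = r *\<^sub>R sc c x"
  by (simp add: scale_scale[symmetric] sc_of_real del: scale_scale)

lemma bounded_bilinear_sc: "bounded_bilinear sc"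
proof
  show "sc (r *\<^sub>R c) x = r *\<^sub>R sc c x" for r c x
    by (simp add: scaleR_conv_of_real sc_of_real_mult)
  show "sc c (r *\<^sub>R x) = r *\<^sub>R sc c x" for r c x
    by (metis sc_of_real scale_left_commute)
  show "\<exists>K. \<forall>c x. norm (sc c x) \<le> norm c * norm x * K"
    by (intro exI[of _ 1]) (simp add: norm_sc)
qed (simp_all add: scale_left_distrib scale_right_distrib)

section \<open>Sequences of bounded variation are multipliers\<close>

lemma bv_w_sum_bound:
  assumes f: "f \<in> bv_w sc"
  obtains C where "\<And>v B n. (\<And>k. norm (\<Sum>i\<le>k. v i) \<le> B) \<Longrightarrow> norm (\<Sum>i\<le>n. sc (v i) (f i)) \<le> C * B"
proof -
  define T where "T a n = (\<Sum>k<n. sc (a k) (f (Suc k) - f k))" for a n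
  define A where "A = {T a n |a n. \<forall>k. norm (a k) \<le> 1}"
  \<comment> \<open>Each functional is bounded on \<open>A\<close> by the variation of its
    composition with \<open>f\<close>.\<close>
  have "bounded A"
  proof (rule bounded_if_dual_bounded)
    fix \<phi> assume phi: "\<phi> \<in> dual_space sc"
    then have lin: "linear \<phi>" and hom: "\<And>c x. \<phi> (sc c x) = c * \<phi> x"
      by (auto simp: dual_space_def bounded_linear.linear)
    have summ: "summable (\<lambda>n. norm (\<phi> (f (Suc n)) - \<phi> (f n)))"
      using f phi by (auto simp: bv_w_def bv_def)
    have "norm (\<phi> (T a n)) \<le> (\<Sum>k. norm (\<phi> (f (Suc k)) - \<phi> (f k)))"
      if a: "\<forall>k. norm (a k) \<le> 1" for a n
    proof -
      have "norm (\<phi> (T a n)) = norm (\<Sum>k<n. a k * (\<phi> (f (Suc k)) - \<phi> (f k)))"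
        by (simp add: T_def linear_sum[OF lin] hom linear_diff[OF lin])
      also have "\<dots> \<le> (\<Sum>k<n. norm (\<phi> (f (Suc k)) - \<phi> (f k)))"
        using a by (intro sum_norm_le) (simp add: norm_mult mult_left_le_one_le)
      also have "\<dots> \<le> (\<Sum>k. norm (\<phi> (f (Suc k)) - \<phi> (f k)))"
        by (rule sum_le_suminf[OF summ]) auto
      finally show ?thesis .
    qed
    then show "bounded (\<phi> ` A)" by (auto simp: A_def bounded_iff)
  qed
  then obtain D where "\<And>x. x \<in> A \<Longrightarrow> norm x \<le> D" by (auto simp: bounded_iff)
  then have D: "norm (T a n) \<le> D" if "\<And>k. norm (a k) \<le> 1" for a n
    using that by (auto simp: A_def)
  have f_le: "norm (f n) \<le> norm (f 0) + D" for n
  proof -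
    have "f n = f 0 + T (\<lambda>_. 1) n" by (induction n) (simp_all add: T_def)
    then show ?thesis using D[of "\<lambda>_. 1" n] norm_triangle_ineq[of "f 0" "T (\<lambda>_. 1) n"] by simp
  qed
  \<comment> \<open>One \<open>D\<close> comes from the bound on \<open>f n\<close> in the boundary
    term, the other from \<open>T V n\<close>.\<close>
  have "norm (\<Sum>i\<le>n. sc (v i) (f i)) \<le> (norm (f 0) + 2 * D) * B"
    if v: "\<And>k. norm (\<Sum>i\<le>k. v i) \<le> B" for v B n
  proof -
    define V where "V k = (\<Sum>i\<le>k. v i)" for k
    have V: "norm (V k) \<le> B" for k using v by (simp add: V_def)
    have B: "0 \<le> B" using order_trans[OF norm_ge_zero V] .
    \<comment> \<open>Scaling to coefficients of norm at most \<open>1\<close>. If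
      \<open>B = 0\<close>, then \<open>V k = 0\<close> and the quotient is \<open>0\<close> by
      convention.\<close>
    have "V k = of_real B * (V k / of_real B)" for k
      using V[of k] by (cases "B = 0") auto
    then have "T V n = B *\<^sub>R T (\<lambda>k. V k / of_real B) n"
      unfolding T_def scaleR_sum_right sc_of_real_mult[symmetric] by simp
    moreover have "norm (V k / of_real B) \<le> 1" for k
      using V[of k] B by (cases "B = 0") (auto simp: norm_divide divide_le_eq_1)
    ultimately have T: "norm (T V n) \<le> B * D"
      using D[of "\<lambda>k. V k / of_real B" n] B by (simp add: mult_left_mono)
    have "(\<Sum>i\<le>n. sc (v i) (f i)) = sc (V n) (f n) - T V n"
      using bounded_bilinear.sum_by_parts[OF bounded_bilinear_sc] by (simp add: T_def V_def)
    moreover have "norm (sc (V n) (f n)) \<le> B * (norm (f 0) + D)"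
      unfolding norm_sc by (intro mult_mono V f_le B) auto
    ultimately show ?thesis
      using norm_triangle_ineq4[of "sc (V n) (f n)" "T V n"] T by (smt (verit) distrib_left mult.commute)
  qed
  then show thesis by (rule that)
qed

text \<open>The variation is measured in norm here, so the triangle inequality bounds the sum
  directly.\<close>

lemma bv_sum_bound:
  assumes f: "f \<in> bv"
  obtains C where "\<And>v B n. (\<And>k. norm (\<Sum>i\<le>k. v i) \<le> B) \<Longrightarrow> norm (\<Sum>i\<le>n. sc (f i) (v i)) \<le> C * B"
proof -
  define D where "D = (\<Sum>k. norm (f (Suc k) - f k))"
  have summ: "summable (\<lambda>k. norm (f (Suc k) - f k))" using f by (simp add: bv_def)
  have D: "(\<Sum>k<n. norm (f (Suc k) - f k)) \<le> D" for n
    unfolding D_def by (rule sum_le_suminf[OF summ]) auto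
  have f_le: "norm (f n) \<le> norm (f 0) + D" for n
  proof -
    have "norm (f n - f 0) \<le> (\<Sum>k<n. norm (f (Suc k) - f k))"
      unfolding sum_lessThan_telescope[symmetric] by (rule norm_sum)
    with D[of n] norm_triangle_ineq2[of "f n" "f 0"] show ?thesis by linarith
  qed
  have "norm (\<Sum>i\<le>n. sc (f i) (v i)) \<le> (norm (f 0) + 2 * D) * B"
    if v: "\<And>k. norm (\<Sum>i\<le>k. v i) \<le> B" for v B n
  proof -
    define V where "V k = (\<Sum>i\<le>k. v i)" for k
    have V: "norm (V k) \<le> B" for k using v by (simp add: V_def)
    have B: "0 \<le> B" using order_trans[OF norm_ge_zero V] .
    have "norm (\<Sum>k<n. sc (f (Suc k) - f k) (V k)) \<le> (\<Sum>k<n. norm (f (Suc k) - f k) * B)"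
      by (intro sum_norm_le) (simp add: norm_sc mult_left_mono V)
    also have "\<dots> \<le> D * B"
      unfolding sum_distrib_right[symmetric] by (intro mult_right_mono D B)
    finally have T: "norm (\<Sum>k<n. sc (f (Suc k) - f k) (V k)) \<le> D * B" .
    have "(\<Sum>i\<le>n. sc (f i) (v i)) = sc (f n) (V n) - (\<Sum>k<n. sc (f (Suc k) - f k) (V k))"
      using bounded_bilinear.sum_by_parts[OF bounded_bilinear.flip[OF bounded_bilinear_sc]]
      by (simp add: V_def)
    moreover have "norm (sc (f n) (V n)) \<le> (norm (f 0) + D) * B"
      unfolding norm_sc using B f_le[of n] by (intro mult_mono V order_trans[OF norm_ge_zero f_le]) auto
    ultimately show ?thesis
      using norm_triangle_ineq4[of "sc (f n) (V n)"] T by (smt (verit) distrib_right)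
  qed
  then show thesis by (rule that)
qed

lemma bv_w_subset_mult_vec:
  "bv_w sc \<subseteq> mult_vec sc Sigma_linf Sigma_linf"
  "bv_w sc \<subseteq> mult_vec sc Sigma_c Sigma_c"
proof -
  have "v \<in> Sigma_linf \<Longrightarrow> (\<lambda>n. sc (v n) (f n)) \<in> Sigma_linf"
    "v \<in> Sigma_c \<Longrightarrow> (\<lambda>n. sc (v n) (f n)) \<in> Sigma_c" if "f \<in> bv_w sc" for f v
    using bv_w_sum_bound[OF that] Sigma_preserved[of "\<lambda>i c. sc c (f i)"] by (metis scale_zero_left)+
  then show "bv_w sc \<subseteq> mult_vec sc Sigma_linf Sigma_linf" "bv_w sc \<subseteq> mult_vec sc Sigma_c Sigma_c"
    by (auto simp: mult_vec_def)
qed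

lemma bv_subset_mult_scal:
  "bv \<subseteq> mult_scal sc Sigma_linf Sigma_linf"
  "bv \<subseteq> mult_scal sc Sigma_c Sigma_c"
proof -
  have "v \<in> Sigma_linf \<Longrightarrow> (\<lambda>n. sc (f n) (v n)) \<in> Sigma_linf"
    "v \<in> Sigma_c \<Longrightarrow> (\<lambda>n. sc (f n) (v n)) \<in> Sigma_c" if "f \<in> bv" for f v
    using bv_sum_bound[OF that] Sigma_preserved[of "\<lambda>i. sc (f i)"] by (metis scale_zero_right)+
  then show "bv \<subseteq> mult_scal sc Sigma_linf Sigma_linf" "bv \<subseteq> mult_scal sc Sigma_c Sigma_c"
    by (auto simp: mult_scal_def)
qed

section \<open>Multipliers in a Banach space have bounded variation\<close>

text \<open>The mixed class contains both multiplier classes of interest, so one inclusion settles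
  both.\<close>

lemma mult_vec_subset_bv_w: "mult_vec sc Sigma_c Sigma_linf \<subseteq> bv_w sc"
  unfolding bv_w_def
proof (intro subsetI CollectI ballI)
  fix f \<phi> assume f: "f \<in> mult_vec sc Sigma_c Sigma_linf" and phi: "\<phi> \<in> dual_space sc"
  then have bl: "bounded_linear \<phi>" by (simp add: dual_space_def)
  show "(\<lambda>n. \<phi> (f n)) \<in> bv"
  proof (rule bv_if_multiplier)
    fix w :: "nat \<Rightarrow> real" assume "w \<in> Sigma_c"
    then have "(\<lambda>n. of_real (w n) :: 'k) \<in> Sigma_c"
      by (rule Sigma_c_bounded_linear[OF bounded_linear_of_real])
    with f have "(\<lambda>n. w n *\<^sub>R f n) \<in> Sigma_linf"
      by (auto simp: mult_vec_def sc_of_real)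
    from Sigma_linf_bounded_linear[OF bl this]
    show "(\<lambda>n. w n *\<^sub>R \<phi> (f n)) \<in> Sigma_linf"
      by (simp add: linear_scale[OF bounded_linear.linear[OF bl]])
  qed
qed

text \<open>Testing on multiples of a fixed \<open>x\<close> and dividing by \<open>norm x\<close>
  recovers the scalar sums.\<close>

lemma mult_scal_subset_bv:
  fixes x :: 'a
  assumes "x \<noteq> 0"
  shows "mult_scal sc Sigma_c Sigma_linf \<subseteq> bv"
proof
  fix f assume f: "f \<in> mult_scal sc Sigma_c Sigma_linf"
  show "f \<in> bv"
  proof (rule bv_if_multiplier)
    fix w :: "nat \<Rightarrow> real" assume "w \<in> Sigma_c"
    then have "(\<lambda>n. w n *\<^sub>R x) \<in> Sigma_c"
      by (rule Sigma_c_bounded_linear[OF bounded_linear_scaleR_left])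
    with f have "(\<lambda>n. sc (f n) (w n *\<^sub>R x)) \<in> Sigma_linf"
      by (auto simp: mult_scal_def)
    moreover have "sc (f n) (w n *\<^sub>R x) = sc (w n *\<^sub>R f n) x" for n
      by (simp add: scaleR_conv_of_real sc_of_real[symmetric] mult.commute)
    ultimately have "(\<lambda>n. sc (w n *\<^sub>R f n) x) \<in> Sigma_linf" by simp
    then obtain B where "\<And>n. norm (\<Sum>k\<le>n. w k *\<^sub>R f k) * norm x \<le> B"
      by (auto simp: Sigma_linf_iff scale_sum_left[symmetric] norm_sc)
    then have "norm (\<Sum>k\<le>n. w k *\<^sub>R f k) \<le> B / norm x" for n
      using assms by (simp add: field_simps)
    then show "(\<lambda>n. w n *\<^sub>R f n) \<in> Sigma_linf" by (auto simp: Sigma_linf_iff)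
  qed
qed

lemma multipliers:
  "mult_vec sc Sigma_linf Sigma_linf = bv_w sc"
  "mult_vec sc Sigma_c Sigma_c = bv_w sc"
  "(x :: 'a) \<noteq> 0 \<Longrightarrow> mult_scal sc Sigma_linf Sigma_linf = bv"
  "(x :: 'a) \<noteq> 0 \<Longrightarrow> mult_scal sc Sigma_c Sigma_c = bv"
proof -
  have "mult_vec sc Sigma_linf Sigma_linf \<subseteq> mult_vec sc Sigma_c Sigma_linf"
    "mult_vec sc Sigma_c Sigma_c \<subseteq> mult_vec sc Sigma_c Sigma_linf"
    using Sigma_c_subset_Sigma_linf by (fastforce simp: mult_vec_def)+
  then show "mult_vec sc Sigma_linf Sigma_linf = bv_w sc" "mult_vec sc Sigma_c Sigma_c = bv_w sc"
    using bv_w_subset_mult_vec mult_vec_subset_bv_w by blast+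
  have "mult_scal sc Sigma_linf Sigma_linf \<subseteq> mult_scal sc Sigma_c Sigma_linf"
    "mult_scal sc Sigma_c Sigma_c \<subseteq> mult_scal sc Sigma_c Sigma_linf"
    using Sigma_c_subset_Sigma_linf by (fastforce simp: mult_scal_def)+
  then show "mult_scal sc Sigma_linf Sigma_linf = bv" "mult_scal sc Sigma_c Sigma_c = bv" if "x \<noteq> 0" for x :: 'a
    using bv_subset_mult_scal mult_scal_subset_bv[OF that] by blast+
qed

end

section \<open>The real and complex instances\<close>

lemma banach_scaling_scaleR: "banach_scaling (scaleR :: real \<Rightarrow> 'a::banach \<Rightarrow> 'a)"
proof unfold_locales
  fix A :: "'a set"
  assume "\<And>\<phi> :: 'a \<Rightarrow> real. \<phi> \<in> dual_space scaleR \<Longrightarrow> bounded (\<phi> ` A)"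
  then show "bounded A" by (rule bounded_if_weakly_bounded) (simp add: dual_space_scaleR)
qed (simp_all add: algebra_simps)

text \<open>Every bounded real-linear functional \<open>u\<close> is the real part of the bounded complex-linear
  functional \<open>x \<mapsto> u x - \<i> u (\<i> x)\<close>.\<close>

lemma (in complex_banach_space) banach_scaling_scaleC: "banach_scaling scaleC"
proof unfold_locales
  show "scaleC (of_real r) x = r *\<^sub>R x" for r x by (rule scaleC_of_real)
  show "norm (scaleC c x) = norm c * norm x" for c x by (rule norm_scaleC)
  fix A :: "'a set"
  assume dual: "\<And>\<phi>. \<phi> \<in> dual_space scaleC \<Longrightarrow> bounded (\<phi> ` A)"
  show "bounded A"
  proof (rule bounded_if_weakly_bounded)
    fix u :: "'a \<Rightarrow> real" assume u: "bounded_linear u"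
    define \<phi> where "\<phi> x = Complex (u x) (- u (scaleC \<i> x))" for x
    have lin: "linear u" using u by (rule bounded_linear.linear)
    have bl: "bounded_linear (scaleC \<i>)"
    proof (rule bounded_linear_intro[where K = 1])
      show "scaleC \<i> (r *\<^sub>R x) = r *\<^sub>R scaleC \<i> x" for r x
        by (metis scaleC_of_real scale_left_commute)
    qed (simp_all add: scale_right_distrib norm_scaleC)
    have "bounded_linear \<phi>"
    proof -
      have "\<phi> = (\<lambda>x. of_real (u x) - \<i> * of_real (u (scaleC \<i> x)))"
        by (auto simp: \<phi>_def complex_eq_iff)
      then show ?thesis
        by (simp only:) (intro bounded_linear_sub bounded_linear_const_mult
          bounded_linear_compose[OF bounded_linear_of_real] bounded_linear_compose[OF u] u bl)
    qed
    moreover have "\<phi> (scaleC c x) = c * \<phi> x" for c x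
    proof -
      \<comment> \<open>Splitting \<open>c\<close> reduces complex homogeneity to real linearity and
        multiplication by \<open>\<i>\<close>.\<close>
      have c: "scaleC c y = Re c *\<^sub>R y + Im c *\<^sub>R scaleC \<i> y" for y
        by (subst complex_eq[of c])
          (simp add: scale_left_distrib scaleC_of_real mult.commute[of \<i>] scale_scale[symmetric] del: scale_scale)
      have "scaleC \<i> (scaleC c x) = Re c *\<^sub>R scaleC \<i> x - Im c *\<^sub>R x"
        unfolding scale_left_commute[of \<i>] using c[of "scaleC \<i> x"] scale_minus_left[of 1 x] by simp
      then show ?thesis
        by (simp add: \<phi>_def c[of x] complex_eq_iff linear_add[OF lin] linear_diff[OF lin] linear_scale[OF lin])
    qed
    ultimately have "bounded (\<phi> ` A)" by (intro dual) (simp add: dual_space_def)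
    then have "bounded (Re ` \<phi> ` A)" by (rule bounded_linear_image[OF _ bounded_linear_Re])
    then show "bounded (u ` A)" by (simp add: image_image \<phi>_def)
  qed
qed

text \<open>A nonzero vector is required for scalar multipliers because over the zero space every
  scalar sequence is one.\<close>

theorem proposition12p2:
  fixes scaleC :: "complex \<Rightarrow> 'b::banach \<Rightarrow> 'b"
  shows
    "((mult_vec scaleR (Sigma_linf :: (nat \<Rightarrow> real) set) (Sigma_linf :: (nat \<Rightarrow> 'a::banach) set)
          = bv_w (scaleR :: real \<Rightarrow> 'a \<Rightarrow> 'a) \<and>
      bv_w (scaleR :: real \<Rightarrow> 'a \<Rightarrow> 'a)
          = mult_vec scaleR (Sigma_c :: (nat \<Rightarrow> real) set) (Sigma_c :: (nat \<Rightarrow> 'a) set)) \<and>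
     ((\<exists>x::'a. x \<noteq> 0) \<longrightarrow>
      mult_scal scaleR (Sigma_linf :: (nat \<Rightarrow> 'a) set) (Sigma_linf :: (nat \<Rightarrow> 'a) set)
          = (bv :: (nat \<Rightarrow> real) set) \<and>
      (bv :: (nat \<Rightarrow> real) set)
          = mult_scal scaleR (Sigma_c :: (nat \<Rightarrow> 'a) set) (Sigma_c :: (nat \<Rightarrow> 'a) set)))
     \<and>
     (complex_banach_space scaleC \<longrightarrow>
     (mult_vec scaleC (Sigma_linf :: (nat \<Rightarrow> complex) set) (Sigma_linf :: (nat \<Rightarrow> 'b) set)
          = bv_w scaleC \<and>
      bv_w scaleC
          = mult_vec scaleC (Sigma_c :: (nat \<Rightarrow> complex) set) (Sigma_c :: (nat \<Rightarrow> 'b) set)) \<and>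
     ((\<exists>x::'b. x \<noteq> 0) \<longrightarrow>
      mult_scal scaleC (Sigma_linf :: (nat \<Rightarrow> 'b) set) (Sigma_linf :: (nat \<Rightarrow> 'b) set)
          = (bv :: (nat \<Rightarrow> complex) set) \<and>
      (bv :: (nat \<Rightarrow> complex) set)
          = mult_scal scaleC (Sigma_c :: (nat \<Rightarrow> 'b) set) (Sigma_c :: (nat \<Rightarrow> 'b) set)))"
proof (intro conjI impI)
  interpret R: banach_scaling "scaleR :: real \<Rightarrow> 'a \<Rightarrow> 'a" by (rule banach_scaling_scaleR)
  show "mult_vec scaleR (Sigma_linf :: (nat \<Rightarrow> real) set) (Sigma_linf :: (nat \<Rightarrow> 'a) set)
      = bv_w (scaleR :: real \<Rightarrow> 'a \<Rightarrow> 'a)"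
    by (rule R.multipliers)
  show "bv_w (scaleR :: real \<Rightarrow> 'a \<Rightarrow> 'a)
      = mult_vec scaleR (Sigma_c :: (nat \<Rightarrow> real) set) (Sigma_c :: (nat \<Rightarrow> 'a) set)"
    by (rule R.multipliers(2)[symmetric])
  assume "\<exists>x::'a. x \<noteq> 0"
  then obtain x :: 'a where "x \<noteq> 0" ..
  then show "mult_scal scaleR (Sigma_linf :: (nat \<Rightarrow> 'a) set) (Sigma_linf :: (nat \<Rightarrow> 'a) set)
        = (bv :: (nat \<Rightarrow> real) set)"
    and "(bv :: (nat \<Rightarrow> real) set)
        = mult_scal scaleR (Sigma_c :: (nat \<Rightarrow> 'a) set) (Sigma_c :: (nat \<Rightarrow> 'a) set)"
    using R.multipliers by auto
next
  assume "complex_banach_space scaleC"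
  then interpret C: banach_scaling scaleC by (rule complex_banach_space.banach_scaling_scaleC)
  show "mult_vec scaleC (Sigma_linf :: (nat \<Rightarrow> complex) set) (Sigma_linf :: (nat \<Rightarrow> 'b) set)
      = bv_w scaleC"
    by (rule C.multipliers)
  show "bv_w scaleC
      = mult_vec scaleC (Sigma_c :: (nat \<Rightarrow> complex) set) (Sigma_c :: (nat \<Rightarrow> 'b) set)"
    by (rule C.multipliers(2)[symmetric])
  assume "\<exists>x::'b. x \<noteq> 0"
  then obtain x :: 'b where "x \<noteq> 0" ..
  then show "mult_scal scaleC (Sigma_linf :: (nat \<Rightarrow> 'b) set) (Sigma_linf :: (nat \<Rightarrow> 'b) set)
        = (bv :: (nat \<Rightarrow> complex) set)"
    and "(bv :: (nat \<Rightarrow> complex) set)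
        = mult_scal scaleC (Sigma_c :: (nat \<Rightarrow> 'b) set) (Sigma_c :: (nat \<Rightarrow> 'b) set)"
    using C.multipliers by auto
qed

end
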